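(* Let $\mathcal{R}$ be a $2$-torsion free commutative ring with unity, let $(X,\leqslant)$ be a locally finite pre-ordered set, and let $\theta$ be a commuting map of the incidence algebra $I(X,\mathcal{R})$. If the set $\mathfrak{D}=\{(x,y)\in X\times X\mid x<y\}$ forms one equivalence class under the relation $\cong$, then $\theta$ is proper.
   Context: Pre-order: a reflexive and transitive binary relation. Locally finite: for all $x\leqslant y$ there are only finitely many $z$ with $x\leqslant z\leqslant y$. A ring is $2$-torsion free if $2r=0$ implies $r=0$. Incidence algebra: $I(X,\mathcal{R})=\{f:X\times X\to\mathcal{R}\mid f(x,y)=0 \text{ if } x\not\leqslant y\}$ with pointwise $\mathcal{R}$-module structure and product $(fg)(x,y)=\sum_{x\leqslant z\leqslant y}f(x,z)g(z,y)$. Commuting maps: for an associative $\mathcal{R}$-algebra $A$ with center $Z(A)$ and $[x,y]=xy-yx$, an $\mathcal{R}$-linear map $\theta:A\to A$ is a commuting map if $[\theta(x),x]=0$ for all $x\in A$. It is proper if there are $\lambda\in Z(A)$ and an $\mathcal{R}$-linear map $\mu:A\to A$ with image in $Z(A)$ such that $\theta(x)=\lambda x+\mu(x)$ for all $x\in A$. Order notation: $x<y$ means $x\leqslant y$ and $x\neq y$ (both $x<y$ and $y<x$ may hold, since $\leqslant$ is only a pre-order). Write $x\sim y$ if $x\leqslant y$ or $y\leqslant x$. Relation $\cong$: let $x_1,\dots,x_n$ ($n\geq 2$) be $n$ different elements of $X$. They form a circle if $x_1\sim x_2$ when $n=2$, and if $x_1\sim x_2,\ x_2\sim x_3,\dots,x_{n-1}\sim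 x_n,\ x_n\sim x_1$ when $n\geq 3$. The circle contains $x\sim y$ if $x,y$ are (in some order) two cyclically consecutive vertices of it. For $(x,y),(u,v)\in\mathfrak{D}$, define $(x,y)\cong(u,v)$ if and only if there is a circle containing both $x\sim y$ and $u\sim v$. This is an equivalence relation on $\mathfrak{D}$; "$\mathfrak{D}$ forms one equivalence class" means that any two elements of $\mathfrak{D}$ are related by $\cong$. *)

theory Defs
  imports Main "HOL-Library.Function_Algebras"
begin

text \<open>
  An algebra is given by a carrier \<open>A\<close> inside an abelian group type, a scalar action
  \<open>sm\<close> and a product \<open>mul\<close>; addition and subtraction are those of the type.
\<close>

definition alg_center :: "('b \<Rightarrow> 'b \<Rightarrow> 'b) \<Rightarrow> 'b set \<Rightarrow> 'b set" where
  "alg_center mul A = {z \<in> A. \<forall>x\<in>A. mul z x = mul x z}"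

definition commutator :: "('b \<Rightarrow> 'b \<Rightarrow> 'b) \<Rightarrow> 'b \<Rightarrow> 'b \<Rightarrow> 'b :: ab_group_add" where
  "commutator mul x y = mul x y - mul y x"

definition linear_endo ::
  "('r \<Rightarrow> 'b \<Rightarrow> 'b) \<Rightarrow> 'b set \<Rightarrow> ('b \<Rightarrow> 'b :: ab_group_add) \<Rightarrow> bool" where
  "linear_endo sm A \<theta> \<longleftrightarrow>
     (\<forall>x\<in>A. \<theta> x \<in> A) \<and>
     (\<forall>x\<in>A. \<forall>y\<in>A. \<theta> (x + y) = \<theta> x + \<theta> y) \<and>
     (\<forall>c. \<forall>x\<in>A. \<theta> (sm c x) = sm c (\<theta> x))"

definition commuting_map ::
  "('r \<Rightarrow> 'b \<Rightarrow> 'b) \<Rightarrow> ('b \<Rightarrow> 'b \<Rightarrow> 'b) \<Rightarrow> 'b set \<Rightarrow> ('b \<Rightarrow> 'b :: ab_group_add) \<Rightarrow> bool" where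
  "commuting_map sm mul A \<theta> \<longleftrightarrow>
     linear_endo sm A \<theta> \<and> (\<forall>x\<in>A. commutator mul (\<theta> x) x = 0)"

definition proper_map ::
  "('r \<Rightarrow> 'b \<Rightarrow> 'b) \<Rightarrow> ('b \<Rightarrow> 'b \<Rightarrow> 'b) \<Rightarrow> 'b set \<Rightarrow> ('b \<Rightarrow> 'b :: ab_group_add) \<Rightarrow> bool" where
  "proper_map sm mul A \<theta> \<longleftrightarrow>
     (\<exists>l \<in> alg_center mul A. \<exists>\<mu>.
        linear_endo sm A \<mu> \<and> (\<forall>x\<in>A. \<mu> x \<in> alg_center mul A) \<and>
        (\<forall>x\<in>A. \<theta> x = mul l x + \<mu> x))"

text \<open>
  A pre-order on a set \<open>X\<close> is a relation \<open>le\<close> with \<open>preorder_on X le\<close>. This includes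
  \<open>le \<subseteq> X \<times> X\<close>, so \<open>X\<close> need not be mentioned below: a function on \<open>X \<times> X\<close> is
  represented by its extension by zero, and comparable elements automatically lie in \<open>X\<close>.
\<close>

definition locally_finite :: "('a \<times> 'a) set \<Rightarrow> bool" where
  "locally_finite le \<longleftrightarrow>
     (\<forall>x y. (x, y) \<in> le \<longrightarrow> finite {z. (x, z) \<in> le \<and> (z, y) \<in> le})"

definition incidence_algebra :: "('a \<times> 'a) set \<Rightarrow> ('a \<Rightarrow> 'a \<Rightarrow> 'r :: zero) set" where
  "incidence_algebra le = {f. \<forall>x y. (x, y) \<notin> le \<longrightarrow> f x y = 0}"

definition incidence_mult ::
  "('a \<times> 'a) set \<Rightarrow> ('a \<Rightarrow> 'a \<Rightarrow> 'r) \<Rightarrow> ('a \<Rightarrow> 'a \<Rightarrow> 'r) \<Rightarrow> 'a \<Rightarrow> 'a \<Rightarrow> 'r :: comm_ring" where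
  "incidence_mult le f g =
     (\<lambda>x y. \<Sum>z\<in>{z. (x, z) \<in> le \<and> (z, y) \<in> le}. f x z * g z y)"

definition incidence_scale ::
  "'r \<Rightarrow> ('a \<Rightarrow> 'a \<Rightarrow> 'r) \<Rightarrow> 'a \<Rightarrow> 'a \<Rightarrow> 'r :: comm_ring" where
  "incidence_scale c f = (\<lambda>x y. c * f x y)"

definition strict_pairs :: "('a \<times> 'a) set \<Rightarrow> ('a \<times> 'a) set" where
  "strict_pairs le = {(x, y). (x, y) \<in> le \<and> x \<noteq> y}"

definition comparable :: "('a \<times> 'a) set \<Rightarrow> 'a \<Rightarrow> 'a \<Rightarrow> bool" where
  "comparable le x y \<longleftrightarrow> (x, y) \<in> le \<or> (y, x) \<in> le"

text \<open>
  A circle is the list of its vertices. As \<open>comparable\<close> is symmetric, for two vertices the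
  cyclic condition is just \<open>x\<^sub>1 \<sim> x\<^sub>2\<close>.
\<close>

definition circle :: "('a \<times> 'a) set \<Rightarrow> 'a list \<Rightarrow> bool" where
  "circle le xs \<longleftrightarrow> length xs \<ge> 2 \<and> distinct xs \<and>
     (\<forall>i<length xs. comparable le (xs ! i) (xs ! (Suc i mod length xs)))"

definition circle_contains :: "'a list \<Rightarrow> 'a \<times> 'a \<Rightarrow> bool" where
  "circle_contains xs p \<longleftrightarrow>
     (\<exists>i<length xs. {fst p, snd p} = {xs ! i, xs ! (Suc i mod length xs)})"

definition circle_related :: "('a \<times> 'a) set \<Rightarrow> 'a \<times> 'a \<Rightarrow> 'a \<times> 'a \<Rightarrow> bool" where
  "circle_related le p q \<longleftrightarrow>
     (\<exists>xs. circle le xs \<and> circle_contains xs p \<and> circle_contains xs q)"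

end

theory Submission
  imports Defs
begin

text \<open>
  Write \<open>e\<^sub>u\<^sub>v\<close> for the matrix units. Linearising \<open>[\<theta>(f), f] = 0\<close> gives
  \<open>[\<theta>(f), g] = [f, \<theta>(g)]\<close>. Taking \<open>g = e\<^sub>u\<^sub>v\<close>, one sees that \<open>\<theta>\<close> is proper with \<open>\<lambda> = c\<close> as soon
  as all \<open>\<theta>(e\<^sub>u\<^sub>v) - c e\<^sub>u\<^sub>v\<close> are central, because an element that commutes with all matrix units is
  central. Comparing entries for pairs of matrix units shows that \<open>\<theta>(e\<^sub>x\<^sub>x)\<close> is diagonal, say with
  diagonal \<open>d\<^sub>x\<close>, that \<open>d\<^sub>x\<close> is constant along edges avoiding \<open>x\<close>, and that the only off-diagonal
  entry of \<open>\<theta>(e\<^sub>u\<^sub>v)\<close> is \<open>d\<^sub>u(u) - d\<^sub>u(v) = d\<^sub>v(v) - d\<^sub>v(u)\<close>. For consecutive edges \<open>v \<sim> u \<sim> w\<close> of a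
  circle, the rest of the circle joins \<open>v\<close> to \<open>w\<close> and avoids \<open>u\<close>, so \<open>d\<^sub>u(v) = d\<^sub>u(w)\<close>, and the two
  edges carry the same value. Hence this value is the same on all edges, and it serves as \<open>c\<close>.
\<close>

section \<open>Matrix units and bilinearity of the incidence product\<close>

text \<open>The sort is that of commutative rings with unity; unlike \<open>comm_ring_1\<close> it
  admits the zero ring.\<close>

definition matrix_unit :: "'a \<Rightarrow> 'a \<Rightarrow> 'a \<Rightarrow> 'a \<Rightarrow> 'r :: {comm_ring, comm_monoid_mult}" where
  "matrix_unit u v = (\<lambda>a b. if a = u \<and> b = v then 1 else 0)"

lemma matrix_unit_mem: "(u, v) \<in> le \<Longrightarrow> matrix_unit u v \<in> incidence_algebra le"
  by (auto simp: matrix_unit_def incidence_algebra_def)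

lemma incidence_mult_add_left:
  "incidence_mult le (f + g) h = incidence_mult le f h + incidence_mult le g h"
  by (simp add: incidence_mult_def fun_eq_iff distrib_right sum.distrib)

lemma incidence_mult_add_right:
  "incidence_mult le f (g + h) = incidence_mult le f g + incidence_mult le f h"
  by (simp add: incidence_mult_def fun_eq_iff distrib_left sum.distrib)

lemma incidence_mult_diff_left:
  "incidence_mult le (f - g) h = incidence_mult le f h - incidence_mult le g h"
  by (simp add: incidence_mult_def fun_eq_iff left_diff_distrib sum_subtractf)

lemma incidence_mult_diff_right:
  "incidence_mult le f (g - h) = incidence_mult le f g - incidence_mult le f h"
  by (simp add: incidence_mult_def fun_eq_iff right_diff_distrib sum_subtractf)

lemma incidence_mult_scale_left:
  "incidence_mult le (incidence_scale c f) g = incidence_scale c (incidence_mult le f g)"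
  by (simp add: incidence_mult_def incidence_scale_def fun_eq_iff sum_distrib_left mult.assoc)

lemma incidence_mult_scale_right:
  "incidence_mult le f (incidence_scale c g) = incidence_scale c (incidence_mult le f g)"
  by (simp add: incidence_mult_def incidence_scale_def fun_eq_iff sum_distrib_left
      mult.left_commute)

lemma commuting_map_linearized:
  assumes "commuting_map sm (incidence_mult le) (incidence_algebra le) \<theta>"
    and f: "f \<in> incidence_algebra le" and g: "g \<in> incidence_algebra le"
  shows "commutator (incidence_mult le) (\<theta> f) g = commutator (incidence_mult le) f (\<theta> g)"
proof -
  have comm: "commutator (incidence_mult le) (\<theta> h) h = 0" if "h \<in> incidence_algebra le" for h
    using assms(1) that by (simp add: commuting_map_def)
  have "f + g \<in> incidence_algebra le"
    using f g by (simp add: incidence_algebra_def)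
  moreover have "\<theta> (f + g) = \<theta> f + \<theta> g"
    using assms by (simp add: commuting_map_def linear_endo_def)
  ultimately have "commutator (incidence_mult le) (\<theta> f + \<theta> g) (f + g) = 0"
    using comm by metis
  with comm[OF f] comm[OF g] show ?thesis
    by (simp add: commutator_def incidence_mult_add_left incidence_mult_add_right algebra_simps)
qed

section \<open>Edge values along a circle\<close>

text \<open>
  Here \<open>d x y\<close> stands for the diagonal entry of \<open>\<theta>(e\<^sub>x\<^sub>x)\<close> at \<open>y\<close>, and \<open>d x x - d x y\<close> is the
  value carried by the edge \<open>x \<sim> y\<close>.
\<close>

locale edge_function =
  fixes le :: "('a \<times> 'a) set" and d :: "'a \<Rightarrow> 'a \<Rightarrow> 'r :: ab_group_add"
  assumes sym: "\<And>x y. comparable le x y \<Longrightarrow> x \<noteq> y \<Longrightarrow> d x x - d x y = d y y - d y x"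
    and avoid: "\<And>x u v. comparable le u v \<Longrightarrow> x \<noteq> u \<Longrightarrow> x \<noteq> v \<Longrightarrow> d x u = d x v"
begin

text \<open>Reading indices modulo the length makes the closing edge an ordinary one. With two
  vertices the path avoiding \<open>p (Suc j)\<close> is a single point and only \<open>sym\<close>
  acts.\<close>

lemma circle_consecutive_edges:
  assumes xs: "circle le xs"
  defines "p \<equiv> \<lambda>j. xs ! (j mod length xs)"
  shows "d (p (Suc j)) (p (Suc j)) - d (p (Suc j)) (p (Suc (Suc j))) =
    d (p j) (p j) - d (p j) (p (Suc j))"
proof -
  let ?n = "length xs"
  have n: "?n \<ge> 2" and dist: "distinct xs"
    using xs by (auto simp: circle_def)
  have step: "comparable le (p i) (p (Suc i))" for i
  proof -
    have "i mod ?n < ?n" using n by (intro mod_less_divisor) linarith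
    then have "comparable le (xs ! (i mod ?n)) (xs ! (Suc (i mod ?n) mod ?n))"
      using xs by (simp add: circle_def del: mod_Suc_eq)
    then show ?thesis
      by (simp add: p_def mod_Suc_eq)
  qed
  have neq: "p i \<noteq> p (i + m)" if "0 < m" "m < ?n" for i m
  proof
    assume "p i = p (i + m)"
    moreover have "i mod ?n < ?n" "(i + m) mod ?n < ?n"
      using n by (auto intro!: mod_less_divisor)
    ultimately have "i mod ?n = (i + m) mod ?n"
      using dist by (simp add: p_def nth_eq_iff_index_eq)
    then have "?n dvd m"
      by (metis add_diff_cancel_left' le_add1 mod_eq_dvd_iff_nat)
    with that show False by (simp add: nat_dvd_not_less)
  qed
  \<comment> \<open>The path starts at \<open>p (Suc (Suc j))\<close> and after
    \<open>length xs - 2\<close> steps arrives at \<open>p j\<close>, one step short of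
    \<open>p (Suc j)\<close>.\<close>
  have "k + 2 \<le> ?n \<Longrightarrow> d (p (Suc j)) (p (Suc (Suc j) + k)) = d (p (Suc j)) (p (Suc (Suc j)))" for k
  proof (induction k)
    case (Suc k)
    have "d (p (Suc j)) (p (Suc (Suc j) + k)) = d (p (Suc j)) (p (Suc (Suc (Suc j) + k)))"
      using step neq[of "Suc k" "Suc j"] neq[of "Suc (Suc k)" "Suc j"] Suc.prems
      by (intro avoid) auto
    with Suc show ?case by simp
  qed simp
  from this[of "?n - 2"]
  have "d (p (Suc j)) (p (Suc (Suc j) + (?n - 2))) = d (p (Suc j)) (p (Suc (Suc j)))"
    using n by simp
  moreover have "p (Suc (Suc j) + (?n - 2)) = p j"
  proof -
    have "Suc (Suc j) + (?n - 2) = j + ?n" using n by simp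
    then show ?thesis unfolding p_def by (simp only: mod_add_self2)
  qed
  moreover have "d (p j) (p j) - d (p j) (p (Suc j)) = d (p (Suc j)) (p (Suc j)) - d (p (Suc j)) (p j)"
    using step neq[of 1 j] n by (intro sym) auto
  ultimately show ?thesis by simp
qed

lemma circle_contains_edge_value:
  assumes xs: "circle le xs" and xy: "circle_contains xs (x, y)"
    and "comparable le x y" "x \<noteq> y"
  shows "d x x - d x y = d (xs ! 0) (xs ! 0) - d (xs ! 0) (xs ! 1)"
proof -
  define p where "p j = xs ! (j mod length xs)" for j
  have n: "length xs \<ge> 2" using xs by (simp add: circle_def)
  have const: "d (p j) (p j) - d (p j) (p (Suc j)) = d (p 0) (p 0) - d (p 0) (p 1)" for j
  proof (induction j)
    case (Suc j)
    then show ?case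
      using circle_consecutive_edges[OF xs, of j] by (simp add: p_def)
  qed simp
  obtain i where "i < length xs" "{x, y} = {xs ! i, xs ! (Suc i mod length xs)}"
    using xy by (auto simp: circle_contains_def)
  then have "{x, y} = {p i, p (Suc i)}"
    by (simp add: p_def)
  \<comment> \<open>The set equality leaves the orientation of the edge open; by \<open>sym\<close>
    the value does not depend on it.\<close>
  then have "d x x - d x y = d (p i) (p i) - d (p i) (p (Suc i))"
    using sym[of x y] assms(3,4) by (auto simp: doubleton_eq_iff)
  also have "\<dots> = d (p 0) (p 0) - d (p 0) (p 1)" by (rule const)
  finally show ?thesis using n by (simp add: p_def)
qed

lemma circle_related_edge_value:
  assumes "circle_related le (x, y) (u, v)"
    and "(x, y) \<in> strict_pairs le" "(u, v) \<in> strict_pairs le"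
  shows "d x x - d x y = d u u - d u v"
proof -
  obtain xs where xs: "circle le xs" "circle_contains xs (x, y)" "circle_contains xs (u, v)"
    using assms(1) by (auto simp: circle_related_def)
  have "comparable le x y" "x \<noteq> y" "comparable le u v" "u \<noteq> v"
    using assms(2,3) by (auto simp: strict_pairs_def comparable_def)
  then show ?thesis
    using circle_contains_edge_value[OF xs(1,2)]
      circle_contains_edge_value[OF xs(1,3)] by simp
qed

end

section \<open>Products with matrix units, diagonal elements and the center\<close>

locale locally_finite_preorder =
  fixes X :: "'a set" and le :: "('a \<times> 'a) set"
  assumes preorder: "preorder_on X le" and locally_finite: "locally_finite le"
begin

lemma le_trans: "(x, y) \<in> le \<Longrightarrow> (y, z) \<in> le \<Longrightarrow> (x, z) \<in> le"
  using preorder by (auto simp: preorder_on_def dest: transD)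

lemma le_refl: assumes "(x, y) \<in> le" shows "(x, x) \<in> le" "(y, y) \<in> le"
  using preorder assms by (auto simp: preorder_on_def refl_on_def)

lemma finite_interval: "finite {z. (x, z) \<in> le \<and> (z, y) \<in> le}"
proof (cases "(x, y) \<in> le")
  case True
  then show ?thesis using locally_finite by (auto simp: locally_finite_def)
next
  case False
  then have "{z. (x, z) \<in> le \<and> (z, y) \<in> le} = {}" using le_trans by blast
  then show ?thesis by (simp only: finite.emptyI)
qed

text \<open>Only the summand \<open>z = u\<close> can be nonzero. If it is missing from the sum for
  \<open>y = v\<close>, then \<open>(x, u) \<notin> le\<close> and \<open>f x u\<close> is 0
  anyway.\<close>

lemma incidence_mult_matrix_unit_right:
  assumes f: "f \<in> incidence_algebra le" and uv: "(u, v) \<in> le"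
  shows "incidence_mult le f (matrix_unit u v) x y = (if y = v then f x u else 0)"
proof -
  have "incidence_mult le f (matrix_unit u v) x y =
      (\<Sum>z\<in>{z. (x, z) \<in> le \<and> (z, y) \<in> le}. if z = u then if y = v then f x u else 0 else 0)"
    unfolding incidence_mult_def matrix_unit_def by (intro sum.cong) auto
  also have "\<dots> = (if y = v then f x u else 0)"
    using f uv by (auto simp: sum.delta[OF finite_interval] incidence_algebra_def)
  finally show ?thesis .
qed

lemma incidence_mult_matrix_unit_left:
  assumes f: "f \<in> incidence_algebra le" and uv: "(u, v) \<in> le"
  shows "incidence_mult le (matrix_unit u v) f x y = (if x = u then f v y else 0)"
proof -
  have "incidence_mult le (matrix_unit u v) f x y =
      (\<Sum>z\<in>{z. (x, z) \<in> le \<and> (z, y) \<in> le}. if z = v then if x = u then f v y else 0 else 0)"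
    unfolding incidence_mult_def matrix_unit_def by (intro sum.cong) auto
  also have "\<dots> = (if x = u then f v y else 0)"
    using f uv by (auto simp: sum.delta[OF finite_interval] incidence_algebra_def)
  finally show ?thesis .
qed

lemma commutator_matrix_unit_right:
  assumes "f \<in> incidence_algebra le" and "(u, v) \<in> le"
  shows "commutator (incidence_mult le) f (matrix_unit u v) a b =
    (if b = v then f a u else 0) - (if a = u then f v b else 0)"
  using assms
  by (simp add: commutator_def incidence_mult_matrix_unit_left incidence_mult_matrix_unit_right)

lemma commutator_matrix_unit_left:
  assumes "f \<in> incidence_algebra le" and "(u, v) \<in> le"
  shows "commutator (incidence_mult le) (matrix_unit u v) f a b =
    (if a = u then f v b else 0) - (if b = v then f a u else 0)"
  using assms
  by (simp add: commutator_def incidence_mult_matrix_unit_left incidence_mult_matrix_unit_right)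

lemma diagonal_incidence_mult:
  assumes f: "f \<in> incidence_algebra le" and z: "\<And>x y. x \<noteq> y \<Longrightarrow> z x y = 0"
  shows "incidence_mult le z f x y = z x x * f x y"
    and "incidence_mult le f z x y = f x y * z y y"
proof -
  let ?I = "{w. (x, w) \<in> le \<and> (w, y) \<in> le}"
  have "incidence_mult le z f x y = (\<Sum>w\<in>?I. if w = x then z x x * f x y else 0)"
    unfolding incidence_mult_def using z by (intro sum.cong) auto
  then show "incidence_mult le z f x y = z x x * f x y"
    using f le_refl(1)[of x y]
    by (cases "(x, y) \<in> le") (auto simp: sum.delta[OF finite_interval] incidence_algebra_def)
  have "incidence_mult le f z x y = (\<Sum>w\<in>?I. if w = y then f x y * z y y else 0)"
    unfolding incidence_mult_def using z by (intro sum.cong) auto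
  then show "incidence_mult le f z x y = f x y * z y y"
    using f le_refl(2)[of x y]
    by (cases "(x, y) \<in> le") (auto simp: sum.delta[OF finite_interval] incidence_algebra_def)
qed

text \<open>A diagonal element scales rows from the left and columns from the right; the factors
  agree wherever an element of the algebra can be nonzero.\<close>

lemma diagonal_centralI:
  assumes "z \<in> incidence_algebra le" and diag: "\<And>x y. x \<noteq> y \<Longrightarrow> z x y = 0"
    and const: "\<And>x y. (x, y) \<in> le \<Longrightarrow> x \<noteq> y \<Longrightarrow> z x x = z y y"
  shows "z \<in> alg_center (incidence_mult le) (incidence_algebra le)"
proof -
  have "incidence_mult le z f = incidence_mult le f z" if f: "f \<in> incidence_algebra le" for f
  proof (intro ext)
    fix x y
    show "incidence_mult le z f x y = incidence_mult le f z x y"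
    proof (cases "(x, y) \<in> le")
      case True
      then have "z x x = z y y" using const by (cases "x = y") auto
      then show ?thesis
        by (simp add: diagonal_incidence_mult[OF f diag] mult.commute)
    next
      case False
      then have "f x y = 0" using f by (simp add: incidence_algebra_def)
      then show ?thesis by (simp add: diagonal_incidence_mult[OF f diag])
    qed
  qed
  with assms(1) show ?thesis by (simp add: alg_center_def)
qed

text \<open>For \<open>x \<noteq> y\<close>, the commutator at \<open>(x, y)\<close> is
  \<open>z x y\<close> for \<open>matrix_unit y y\<close> and \<open>z x x - z y y\<close> for
  \<open>matrix_unit x y\<close>.\<close>

lemma central_if_commutes_with_matrix_units:
  fixes z :: "'a \<Rightarrow> 'a \<Rightarrow> 'r :: {comm_ring, comm_monoid_mult}"
  assumes z: "z \<in> incidence_algebra le"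
    and comm: "\<And>u v. (u, v) \<in> le \<Longrightarrow> commutator (incidence_mult le) z (matrix_unit u v) = 0"
  shows "z \<in> alg_center (incidence_mult le) (incidence_algebra le)"
proof (rule diagonal_centralI[OF z])
  have entry: "(if b = v then z a u else 0) - (if a = u then z v b else 0) = 0"
    if "(u, v) \<in> le" for u v a b
    using commutator_matrix_unit_right[OF z that, of a b] comm[OF that] by simp
  show "z x y = 0" if "x \<noteq> y" for x y
  proof (cases "(x, y) \<in> le")
    case True
    then show ?thesis using entry[OF le_refl(2)[OF True], of y x] that by simp
  qed (use z in \<open>simp add: incidence_algebra_def\<close>)
  show "z x x = z y y" if "(x, y) \<in> le" "x \<noteq> y" for x y
    using entry[OF that(1), of y x] by simp
qed

lemma proper_map_if_central_on_matrix_units: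
  fixes \<theta> :: "('a \<Rightarrow> 'a \<Rightarrow> 'r :: {comm_ring, comm_monoid_mult}) \<Rightarrow> ('a \<Rightarrow> 'a \<Rightarrow> 'r)"
  assumes \<theta>: "commuting_map incidence_scale (incidence_mult le) (incidence_algebra le) \<theta>"
    and central: "\<And>u v. (u, v) \<in> le \<Longrightarrow>
      \<theta> (matrix_unit u v) - incidence_scale c (matrix_unit u v)
        \<in> alg_center (incidence_mult le) (incidence_algebra le)"
  shows "proper_map incidence_scale (incidence_mult le) (incidence_algebra le) \<theta>"
proof -
  let ?Z = "alg_center (incidence_mult le) (incidence_algebra le)"
  \<comment> \<open>This is \<open>c\<close> times the identity of the algebra, whose diagonal is 1
    only on \<open>X\<close>; hence the guard.\<close>
  define l :: "'a \<Rightarrow> 'a \<Rightarrow> 'r" where "l = (\<lambda>x y. if x = y \<and> (x, y) \<in> le then c else 0)"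
  define \<mu> where "\<mu> f = \<theta> f - incidence_scale c f" for f
  have lin: "linear_endo incidence_scale (incidence_algebra le) \<theta>"
    using \<theta> by (simp add: commuting_map_def)
  have mem: "\<mu> f \<in> incidence_algebra le" if "f \<in> incidence_algebra le" for f
    using that lin by (simp add: \<mu>_def linear_endo_def incidence_algebra_def incidence_scale_def)
  have l: "l \<in> ?Z"
    by (rule diagonal_centralI) (auto simp: l_def incidence_algebra_def dest: le_refl)
  have mult_l: "incidence_mult le l f = incidence_scale c f" if f: "f \<in> incidence_algebra le" for f
  proof (intro ext)
    fix x y
    have "incidence_mult le l f x y = l x x * f x y"
      by (rule diagonal_incidence_mult[OF f]) (simp add: l_def)
    also have "\<dots> = incidence_scale c f x y"
      using f le_refl(1)[of x y]
      by (cases "(x, y) \<in> le") (auto simp: l_def incidence_scale_def incidence_algebra_def)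
    finally show "incidence_mult le l f x y = incidence_scale c f x y" .
  qed
  have "\<mu> f \<in> ?Z" if f: "f \<in> incidence_algebra le" for f
  proof (rule central_if_commutes_with_matrix_units[OF mem[OF f]])
    fix u v assume uv: "(u, v) \<in> le"
    let ?e = "matrix_unit u v :: 'a \<Rightarrow> 'a \<Rightarrow> 'r"
    \<comment> \<open>Both sides of the linearised identity change by the same term, so
      \<open>\<mu>\<close> inherits it from \<open>\<theta>\<close>.\<close>
    have "commutator (incidence_mult le) (\<mu> f) ?e = commutator (incidence_mult le) f (\<mu> ?e)"
      using commuting_map_linearized[OF \<theta> f matrix_unit_mem[OF uv]]
      by (simp add: commutator_def \<mu>_def incidence_mult_diff_left incidence_mult_diff_right
          incidence_mult_scale_left incidence_mult_scale_right algebra_simps)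
    also have "\<dots> = 0"
      using central[OF uv] f by (simp add: \<mu>_def alg_center_def commutator_def)
    finally show "commutator (incidence_mult le) (\<mu> f) ?e = 0" .
  qed
  moreover have "linear_endo incidence_scale (incidence_algebra le) \<mu>"
    using lin mem unfolding linear_endo_def
    by (auto simp: \<mu>_def incidence_scale_def fun_eq_iff algebra_simps)
  moreover have "\<theta> f = incidence_mult le l f + \<mu> f" if "f \<in> incidence_algebra le" for f
    using mult_l[OF that] by (simp add: \<mu>_def)
  ultimately show ?thesis
    using l unfolding proper_map_def by blast
qed

section \<open>Entries of the images of matrix units\<close>

context
  fixes \<theta> :: "('a \<Rightarrow> 'a \<Rightarrow> 'r :: {comm_ring, comm_monoid_mult}) \<Rightarrow> ('a \<Rightarrow> 'a \<Rightarrow> 'r)"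
  assumes \<theta>: "commuting_map incidence_scale (incidence_mult le) (incidence_algebra le) \<theta>"
begin

abbreviation \<theta>_unit :: "'a \<Rightarrow> 'a \<Rightarrow> 'a \<Rightarrow> 'a \<Rightarrow> 'r" where
  "\<theta>_unit u v \<equiv> \<theta> (matrix_unit u v)"

lemma \<theta>_unit_mem: "(u, v) \<in> le \<Longrightarrow> \<theta>_unit u v \<in> incidence_algebra le"
  using \<theta> by (simp add: commuting_map_def linear_endo_def matrix_unit_mem)

lemma \<theta>_unit_eq_0: "(u, v) \<in> le \<Longrightarrow> (a, b) \<notin> le \<Longrightarrow> \<theta>_unit u v a b = 0"
  using \<theta>_unit_mem[of u v] by (simp add: incidence_algebra_def)

text \<open>This is the linearised identity for two matrix units, read at \<open>(a, b)\<close>;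
  later index choices leave few terms.\<close>

lemma \<theta>_unit_commutator:
  assumes "(u, v) \<in> le" "(s, t) \<in> le"
  shows "(if b = t then \<theta>_unit u v a s else 0) - (if a = s then \<theta>_unit u v t b else 0) =
    (if a = u then \<theta>_unit s t v b else 0) - (if b = v then \<theta>_unit s t a u else 0)"
  using commuting_map_linearized[OF \<theta> matrix_unit_mem[OF assms(1)] matrix_unit_mem[OF assms(2)]]
    commutator_matrix_unit_right[OF \<theta>_unit_mem[OF assms(1)] assms(2), of a b]
    commutator_matrix_unit_left[OF \<theta>_unit_mem[OF assms(2)] assms(1), of a b]
  by simp

text \<open>Equal units in the linearised identity would only give twice this relation, so the
  original identity is used.\<close>

lemma \<theta>_unit_self_commutator:
  assumes "(u, v) \<in> le"
  shows "(if b = v then \<theta>_unit u v a u else 0) - (if a = u then \<theta>_unit u v v b else 0) = 0"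
proof -
  have "commutator (incidence_mult le) (\<theta>_unit u v) (matrix_unit u v) = 0"
    using \<theta> assms by (simp add: commuting_map_def matrix_unit_mem)
  then show ?thesis
    using commutator_matrix_unit_right[OF \<theta>_unit_mem[OF assms] assms, of a b] by simp
qed

text \<open>Entries in row or column \<open>x\<close> vanish by the self-commutator, the others by
  pairing with \<open>matrix_unit b b\<close>.\<close>

lemma \<theta>_unit_diagonal:
  assumes x: "(x, x) \<in> le" and "a \<noteq> b"
  shows "\<theta>_unit x x a b = 0"
proof (cases "(a, b) \<in> le")
  case True
  consider "b = x" | "a = x" | "a \<noteq> x" "b \<noteq> x" by blast
  then show ?thesis
  proof cases
    case 1
    then show ?thesis using \<theta>_unit_self_commutator[OF x, of x a] assms(2) by simp
  next
    case 2
    then show ?thesis using \<theta>_unit_self_commutator[OF x, of b x] assms(2) by simp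
  next
    case 3
    then show ?thesis
      using \<theta>_unit_commutator[OF x le_refl(2)[OF True], of b a] assms(2) by simp
  qed
qed (use \<theta>_unit_eq_0[OF x] in simp)

text \<open>Pairing with \<open>matrix_unit a a\<close> expresses the entry through entries of
  \<open>\<theta>_unit a a\<close> at \<open>(a, u)\<close> if \<open>b = v\<close> and at
  \<open>(v, b)\<close> if \<open>a = u\<close>. As that element is diagonal, a contribution
  requires both.\<close>

lemma \<theta>_unit_off_diagonal:
  assumes uv: "(u, v) \<in> le" "u \<noteq> v" and "a \<noteq> b"
  shows "\<theta>_unit u v a b = (if a = u \<and> b = v then \<theta>_unit u u u u - \<theta>_unit u u v v else 0)"
proof (cases "(a, b) \<in> le")
  case True
  note a = le_refl(1)[OF True]
  show ?thesis
    using \<theta>_unit_commutator[OF a uv(1), of b a] \<theta>_unit_diagonal[OF a, of a u]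
      \<theta>_unit_diagonal[OF a, of v b] assms
    by (auto split: if_splits)
qed (use assms \<theta>_unit_eq_0[OF uv(1)] in auto)

lemma \<theta>_unit_diagonal_along_edge:
  assumes "(x, x) \<in> le" and "comparable le u v" and "x \<noteq> u" "x \<noteq> v"
  shows "\<theta>_unit x x u u = \<theta>_unit x x v v"
proof -
  have "\<theta>_unit x x u u = \<theta>_unit x x v v" if "(u, v) \<in> le" "x \<noteq> u" "x \<noteq> v" for u v
    using \<theta>_unit_commutator[OF assms(1) that(1), of v u] that by simp
  then show ?thesis using assms(2-4) unfolding comparable_def by metis
qed

text \<open>If \<open>(u, v) \<in> le\<close>, both sides are the entry of
  \<open>\<theta>_unit u v\<close> at \<open>(u, v)\<close>, computed once from
  \<open>matrix_unit u u\<close> and once from \<open>matrix_unit v v\<close>.\<close>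

lemma \<theta>_unit_edge_value_sym:
  assumes "comparable le u v" and "u \<noteq> v"
  shows "\<theta>_unit u u u u - \<theta>_unit u u v v = \<theta>_unit v v v v - \<theta>_unit v v u u"
proof -
  have *: "\<theta>_unit u u u u - \<theta>_unit u u v v = \<theta>_unit v v v v - \<theta>_unit v v u u"
    if uv: "(u, v) \<in> le" "u \<noteq> v" for u v
  proof -
    have "\<theta>_unit u v u v = \<theta>_unit u u u u - \<theta>_unit u u v v"
      using \<theta>_unit_off_diagonal[OF uv uv(2)] by simp
    moreover have "\<theta>_unit u v u v = \<theta>_unit v v v v - \<theta>_unit v v u u"
      using \<theta>_unit_commutator[OF le_refl(2)[OF uv(1)] uv(1), of v u] uv(2)
      by (simp add: algebra_simps)
    ultimately show ?thesis by simp
  qed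
  from assms show ?thesis
    unfolding comparable_def using *[of u v] *[of v u] by auto
qed

lemma proper_map_if_edge_value_const:
  assumes c: "\<And>u v. (u, v) \<in> le \<Longrightarrow> u \<noteq> v \<Longrightarrow> \<theta>_unit u u u u - \<theta>_unit u u v v = c"
  shows "proper_map incidence_scale (incidence_mult le) (incidence_algebra le) \<theta>"
proof (rule proper_map_if_central_on_matrix_units[OF \<theta>, of c])
  fix u v assume uv: "(u, v) \<in> le"
  \<comment> \<open>For a diagonal unit, \<open>c\<close> handles the edges that start at its index
    and \<open>c'\<close> those that end there.\<close>
  have c': "\<theta>_unit v v v v - \<theta>_unit v v u u = c" if "(u, v) \<in> le" "u \<noteq> v" for u v
    using c[OF that] \<theta>_unit_edge_value_sym[of u v] that by (simp add: comparable_def)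
  show "\<theta>_unit u v - incidence_scale c (matrix_unit u v)
      \<in> alg_center (incidence_mult le) (incidence_algebra le)"
  proof (rule diagonal_centralI)
    show "\<theta>_unit u v - incidence_scale c (matrix_unit u v) \<in> incidence_algebra le"
      using \<theta>_unit_mem[OF uv] uv
      by (auto simp: incidence_algebra_def incidence_scale_def matrix_unit_def)
    show "(\<theta>_unit u v - incidence_scale c (matrix_unit u v)) a b = 0" if "a \<noteq> b" for a b
      using \<theta>_unit_diagonal[of u a b] \<theta>_unit_off_diagonal[OF uv _ that] c[OF uv] uv that
      by (cases "u = v") (auto simp: incidence_scale_def matrix_unit_def)
    show "(\<theta>_unit u v - incidence_scale c (matrix_unit u v)) a a =
        (\<theta>_unit u v - incidence_scale c (matrix_unit u v)) b b"
      if ab: "(a, b) \<in> le" "a \<noteq> b" for a b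
    proof (cases "u = v")
      case True
      then show ?thesis
        using uv \<theta>_unit_diagonal_along_edge[of u a b] c[of a b] c'[of a b] ab
        by (auto simp: incidence_scale_def matrix_unit_def comparable_def algebra_simps)
    next
      case False
      have "\<theta>_unit u v a a = \<theta>_unit u v b b"
      proof (cases "u = a \<and> v = b")
        case True
        then show ?thesis
          using \<theta>_unit_self_commutator[OF uv, of v u] by simp
      next
        case ne: False
        \<comment> \<open>The entry of \<open>[e\<^sub>u\<^sub>v, \<theta>(e\<^sub>a\<^sub>b)]\<close> at \<open>(a, b)\<close> only involves off-diagonal entries of
          \<open>\<theta>(e\<^sub>a\<^sub>b)\<close> at positions other than \<open>(a, b)\<close>.\<close>
        show ?thesis
          using \<theta>_unit_commutator[OF uv ab(1), of b a] \<theta>_unit_off_diagonal[OF ab, of v b]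
            \<theta>_unit_off_diagonal[OF ab, of a u] ne ab(2) False
          by (auto split: if_splits)
      qed
      then show ?thesis
        using False by (auto simp: incidence_scale_def matrix_unit_def)
    qed
  qed
qed

end

end

theorem theorem3p3:
  fixes X :: "'a set" and le :: "('a \<times> 'a) set"
    and \<theta> :: "('a \<Rightarrow> 'a \<Rightarrow> 'r :: {comm_ring, comm_monoid_mult}) \<Rightarrow> ('a \<Rightarrow> 'a \<Rightarrow> 'r)"
  assumes "\<And>c :: 'r. c + c = 0 \<Longrightarrow> c = 0"
    and "preorder_on X le"
    and "locally_finite le"
    and "commuting_map incidence_scale (incidence_mult le) (incidence_algebra le) \<theta>"
    and "\<forall>p \<in> strict_pairs le. \<forall>q \<in> strict_pairs le. circle_related le p q"
  shows "proper_map incidence_scale (incidence_mult le) (incidence_algebra le) \<theta>"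
proof -
  interpret locally_finite_preorder X le
    using assms(2,3) by unfold_locales
  \<comment> \<open>For \<open>x\<close> outside \<open>X\<close>, \<open>e\<^sub>x\<^sub>x\<close> is not in the algebra and \<open>\<theta>\<close> takes an arbitrary value there.\<close>
  define d where "d x y = (if (x, x) \<in> le then \<theta> (matrix_unit x x) y y else 0)" for x y
  interpret edge_function le d
  proof
    show "d x x - d x y = d y y - d y x" if "comparable le x y" "x \<noteq> y" for x y
      using \<theta>_unit_edge_value_sym[OF assms(4) that] that le_refl
      by (auto simp: d_def comparable_def)
    show "d x u = d x v" if "comparable le u v" "x \<noteq> u" "x \<noteq> v" for x u v
      using \<theta>_unit_diagonal_along_edge[OF assms(4) _ that] by (simp add: d_def)
  qed
  have "d x x - d x y = d u u - d u v"
    if "(x, y) \<in> strict_pairs le" "(u, v) \<in> strict_pairs le" for x y u v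
    using circle_related_edge_value[OF _ that] assms(5) that by blast
  \<comment> \<open>If \<open>strict_pairs le\<close> is empty, any \<open>c\<close> will
    do.\<close>
  then obtain c where c: "\<And>u v. (u, v) \<in> strict_pairs le \<Longrightarrow> d u u - d u v = c"
    by metis
  show ?thesis
  proof (rule proper_map_if_edge_value_const[OF assms(4)])
    fix u v assume "(u, v) \<in> le" "u \<noteq> v"
    with c[of u v] le_refl(1)[of u v]
    show "\<theta> (matrix_unit u u) u u - \<theta> (matrix_unit u u) v v = c"
      by (simp add: d_def strict_pairs_def)
  qed
qed

end
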